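(* Fix an integer $k\ge2$. Let $X_1,X_2,\dots$ be i.i.d. from the Gaussian mixture density $f_{\theta_0}$, where $\theta_0\in\Theta_k$, and assume $\mathbb{E}_{\theta_0}[X^4]<\infty$ (which is automatic for Gaussian mixtures). Let $M_n(\theta)=\frac1n\sum_{i=1}^n\log f_\theta(X_i)$ and $M(\theta)=\mathbb{E}_{\theta_0}[\log f_\theta(X)]$. Then for each fixed $m\ge1$ and $\varepsilon\in(0,1/k]$, $$\sup_{\theta\in\mathcal S_{m,\varepsilon}}|M_n(\theta)-M(\theta)|\to0\quad\text{almost surely.}$$
   Context: For $\theta=(\pi,\mu,t)$ in $\Theta_k=\Delta_{k-1}\times\mathbb{R}^k\times\mathbb{R}^k$, with $\Delta_{k-1}=\{\pi\in[0,1]^k:\sum_j\pi_j=1\}$ and $\sigma_j=e^{t_j}$, the $k$-component Gaussian mixture density is $f_\theta(x)=\sum_{j=1}^k\pi_j\varphi(x;\mu_j,\sigma_j)$, where $\varphi(x;\mu,\sigma)=\frac{1}{\sqrt{2\pi}\,\sigma}\exp(-\frac{(x-\mu)^2}{2\sigma^2})$. The sieve is $\mathcal S_{m,\varepsilon}=\{\pi\in\Delta_{k-1}:\min_j\pi_j\ge\varepsilon\}\times[-m,m]^k\times[-m,m]^k$, in coordinates $(\pi,\mu,t)$. *)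

theory Defs
  imports "HOL-Probability.Probability"
begin

(* A parameter is a triple (weights, means, log-scales); the number k of components
   is the cardinality of the index type 'k. *)
type_synonym 'k param = "(real ^ 'k) \<times> (real ^ 'k) \<times> (real ^ 'k)"

definition prob_simplex :: "(real ^ 'k::finite) set" where
  "prob_simplex = {\<pi>. (\<forall>j. \<pi> $ j \<in> {0..1}) \<and> (\<Sum>j\<in>UNIV. \<pi> $ j) = 1}"

definition param_space :: "'k::finite param set" where
  "param_space = prob_simplex \<times> UNIV \<times> UNIV"

(* The second argument of normal_density is the standard deviation, here exp (t $ j). *)
definition mixture_density :: "'k::finite param \<Rightarrow> real \<Rightarrow> real" where
  "mixture_density = (\<lambda>(\<pi>, \<mu>, t) x. \<Sum>j\<in>UNIV. \<pi> $ j * normal_density (\<mu> $ j) (exp (t $ j)) x)"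

definition mixture_measure :: "'k::finite param \<Rightarrow> real measure" where
  "mixture_measure \<theta> = density lborel (\<lambda>x. ennreal (mixture_density \<theta> x))"

definition sieve :: "real \<Rightarrow> real \<Rightarrow> 'k::finite param set" where
  "sieve m \<epsilon> = {\<pi> \<in> prob_simplex. (MIN j. \<pi> $ j) \<ge> \<epsilon>}
     \<times> {\<mu>. \<forall>j. \<mu> $ j \<in> {-m..m}} \<times> {t. \<forall>j. t $ j \<in> {-m..m}}"

(* The sample is indexed from 0, so the first n observations are x 0, ..., x (n - 1). *)
definition emp_loglik :: "(nat \<Rightarrow> real) \<Rightarrow> nat \<Rightarrow> 'k::finite param \<Rightarrow> real" where
  "emp_loglik x n \<theta> = (1 / real n) * (\<Sum>i<n. ln (mixture_density \<theta> (x i)))"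

definition pop_loglik :: "'k::finite param \<Rightarrow> 'k param \<Rightarrow> real" where
  "pop_loglik \<theta>\<^sub>0 \<theta> = (\<integral>x. ln (mixture_density \<theta> x) \<partial>mixture_measure \<theta>\<^sub>0)"

end

theory Submission
  imports Defs "HOL-Library.Discrete_Functions"
begin

text \<open>
  On the compact sieve each mixture component is the exponential of a function that is Lipschitz in
  the parameter with constant \<open>C (1 + x\<^sup>2)\<close>, and comparing the mixtures term by term
  transfers this bound to the log-density. Hence both the empirical and the population log-likelihood
  are Lipschitz, with constants the empirical and population means of \<open>C (1 + X\<^sup>2)\<close>.
  The finite fourth moment makes these variables and all log-densities square integrable, so a strong
  law for square integrable variables gives convergence of the Lipschitz constants and of the
  log-likelihoods on a countable dense subset of the sieve; compactness makes it uniform.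
\<close>

section \<open>A strong law of large numbers for square integrable variables\<close>

text \<open>With \<open>r\<close> the integer square root of \<open>n\<close>, monotonicity and
  nonnegativity squeeze \<open>S n / n\<close> between \<open>S (r^2) / (r + 1)^2\<close> and
  \<open>S ((r + 1)^2) / r^2\<close>. Both differ from averages along squares only by factors
  tending to 1.\<close>

lemma averages_tendsto_of_square_subsequence:
  fixes S :: "nat \<Rightarrow> real"
  assumes mono: "incseq S" and S0: "0 \<le> S 0"
    and lim: "(\<lambda>k. S (k\<^sup>2) / real (k\<^sup>2)) \<longlonglongrightarrow> \<mu>"
  shows "(\<lambda>n. S n / real n) \<longlonglongrightarrow> \<mu>"
proof -
  define a where "a k = S (k\<^sup>2) / real (k\<^sup>2)" for k
  define r where "r = floor_sqrt"
  have a: "a \<longlonglongrightarrow> \<mu>" using lim by (simp add: a_def[abs_def])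
  have r_top: "filterlim r at_top sequentially"
    unfolding r_def filterlim_at_top
    by (auto simp: eventually_sequentially intro!: le_floor_sqrtI elim!: order_trans)
  have S_nonneg: "0 \<le> S n" for n
    using S0 incseqD[OF mono, of 0 n] by simp
  have lower_lim: "(\<lambda>k. a k * (of_nat k / of_nat (Suc k))\<^sup>2) \<longlonglongrightarrow> \<mu> * 1\<^sup>2"
    by (intro tendsto_intros a LIMSEQ_n_over_Suc_n)
  have upper_lim: "(\<lambda>k. a (Suc k) * (of_nat (Suc k) / of_nat k)\<^sup>2) \<longlonglongrightarrow> \<mu> * 1\<^sup>2"
    by (intro tendsto_intros LIMSEQ_Suc[OF a] LIMSEQ_Suc_n_over_n)
  have lower: "a (r n) * (of_nat (r n) / of_nat (Suc (r n)))\<^sup>2 \<le> S n / real n" if "n > 0" for n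
  proof -
    have r: "r n > 0" "(r n)\<^sup>2 \<le> n" "n < (Suc (r n))\<^sup>2"
      using that Suc_floor_sqrt_power2_gt[of n] by (auto simp: r_def)
    have "a (r n) * (of_nat (r n) / of_nat (Suc (r n)))\<^sup>2 = S ((r n)\<^sup>2) / real ((Suc (r n))\<^sup>2)"
      using r(1) by (simp add: a_def power_divide)
    also have "\<dots> \<le> S n / real n"
      using r that incseqD[OF mono r(2)] S_nonneg
      by (intro frac_le) (auto simp del: of_nat_power simp: of_nat_le_iff)
    finally show ?thesis .
  qed
  have upper: "S n / real n \<le> a (Suc (r n)) * (of_nat (Suc (r n)) / of_nat (r n))\<^sup>2" if "n > 0" for n
  proof -
    have r: "r n > 0" "(r n)\<^sup>2 \<le> n" "n < (Suc (r n))\<^sup>2"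
      using that Suc_floor_sqrt_power2_gt[of n] by (auto simp: r_def)
    have "S n / real n \<le> S ((Suc (r n))\<^sup>2) / real ((r n)\<^sup>2)"
      using r that incseqD[OF mono, of n "(Suc (r n))\<^sup>2"] S_nonneg
      by (intro frac_le) (auto simp del: of_nat_power simp: of_nat_le_iff)
    also have "\<dots> = a (Suc (r n)) * (of_nat (Suc (r n)) / of_nat (r n))\<^sup>2"
      using r(1) by (simp add: a_def power_divide del: of_nat_Suc)
    finally show ?thesis .
  qed
  show ?thesis
    by (rule tendsto_sandwich[OF _ _ filterlim_compose[OF lower_lim r_top, simplified]
          filterlim_compose[OF upper_lim r_top, simplified]])
       (use lower upper in \<open>auto intro!: eventually_mono[OF eventually_gt_at_top[of 0]]\<close>)
qed

text \<open>Expanding the square gives a double sum; by independence each off-diagonal expectation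
  factors into a product of zero means, so only the diagonal survives.\<close>

lemma (in prob_space) expectation_sum_square_indep:
  fixes Z :: "nat \<Rightarrow> 'a \<Rightarrow> real"
  assumes indep: "indep_vars (\<lambda>_. borel) Z UNIV"
    and sq: "\<And>i. integrable M (\<lambda>\<omega>. (Z i \<omega>)\<^sup>2)"
    and mean: "\<And>i. expectation (Z i) = 0"
  shows "integrable M (\<lambda>\<omega>. (\<Sum>i<n. Z i \<omega>)\<^sup>2)"
    and "expectation (\<lambda>\<omega>. (\<Sum>i<n. Z i \<omega>)\<^sup>2) = (\<Sum>i<n. expectation (\<lambda>\<omega>. (Z i \<omega>)\<^sup>2))"
proof -
  have rv: "random_variable borel (Z i)" for i
    using indep by (auto simp: indep_vars_def2)
  have int: "integrable M (Z i)" for i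
    using square_integrable_imp_integrable[OF rv sq] .
  have cross: "integrable M (\<lambda>\<omega>. Z i \<omega> * Z j \<omega>) \<and> expectation (\<lambda>\<omega>. Z i \<omega> * Z j \<omega>) = 0"
    if "i \<noteq> j" for i j
    using indep_vars_lebesgue_integral[of "{i, j}" Z] indep_vars_integrable[of "{i, j}" Z]
      indep_vars_subset[OF indep, of "{i, j}"] int mean that
    by simp
  have prod_int: "integrable M (\<lambda>\<omega>. Z i \<omega> * Z j \<omega>)" for i j
    using cross[of i j] sq[of i] by (cases "i = j") (auto simp: power2_eq_square)
  have square: "(\<Sum>i<n. Z i \<omega>)\<^sup>2 = (\<Sum>i<n. \<Sum>j<n. Z i \<omega> * Z j \<omega>)" for \<omega>
    by (simp add: power2_eq_square sum_product)
  show "integrable M (\<lambda>\<omega>. (\<Sum>i<n. Z i \<omega>)\<^sup>2)"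
    unfolding square by (intro Bochner_Integration.integrable_sum prod_int)
  have "expectation (\<lambda>\<omega>. (\<Sum>i<n. Z i \<omega>)\<^sup>2) = (\<Sum>i<n. \<Sum>j<n. expectation (\<lambda>\<omega>. Z i \<omega> * Z j \<omega>))"
    unfolding square by (simp add: prod_int)
  also have "\<dots> = (\<Sum>i<n. \<Sum>j<n. if i = j then expectation (\<lambda>\<omega>. (Z i \<omega>)\<^sup>2) else 0)"
    using cross by (intro sum.cong refl) (auto simp: power2_eq_square)
  also have "\<dots> = (\<Sum>i<n. expectation (\<lambda>\<omega>. (Z i \<omega>)\<^sup>2))"
    by (simp add: sum.delta)
  finally show "expectation (\<lambda>\<omega>. (\<Sum>i<n. Z i \<omega>)\<^sup>2) = (\<Sum>i<n. expectation (\<lambda>\<omega>. (Z i \<omega>)\<^sup>2))" .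
qed

text \<open>
  Chebyshev's bounds are summable along the squares, and monotonicity of the partial sums of
  nonnegative variables fills the gaps between consecutive squares.
\<close>

lemma (in prob_space) strong_law_nonneg:
  fixes Y :: "nat \<Rightarrow> 'a \<Rightarrow> real"
  assumes indep: "indep_vars (\<lambda>_. borel) Y UNIV"
    and nonneg: "\<And>i \<omega>. 0 \<le> Y i \<omega>"
    and sq: "\<And>i. integrable M (\<lambda>\<omega>. (Y i \<omega>)\<^sup>2)"
    and mean: "\<And>i. expectation (Y i) = \<mu>"
    and var: "\<And>i. variance (Y i) \<le> V"
  shows "AE \<omega> in M. (\<lambda>n. (\<Sum>i<n. Y i \<omega>) / real n) \<longlonglongrightarrow> \<mu>"
proof -
  have rv[measurable]: "random_variable borel (Y i)" for i
    using indep by (auto simp: indep_vars_def2)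
  have int: "integrable M (Y i)" for i
    using square_integrable_imp_integrable[OF rv sq] .
  define Z where "Z i \<omega> = Y i \<omega> - \<mu>" for i \<omega>
  have rvZ[measurable]: "random_variable borel (Z i)" for i
    unfolding Z_def by measurable
  have Z_indep: "indep_vars (\<lambda>_. borel) Z UNIV"
    using indep_vars_compose2[OF indep, of "\<lambda>_ y. y - \<mu>" "\<lambda>_. borel"] by (simp add: Z_def[abs_def])
  have Z_mean: "expectation (Z i) = 0" for i
    using int[of i] by (simp add: Z_def[abs_def] mean prob_space)
  have Z_sq: "integrable M (\<lambda>\<omega>. (Z i \<omega>)\<^sup>2)" for i
    using sq[of i] int[of i] by (simp add: Z_def power2_diff)
  have Z_var: "expectation (\<lambda>\<omega>. (Z i \<omega>)\<^sup>2) \<le> V" for i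
    using var[of i] by (simp add: Z_def mean)
  \<comment> \<open>The squared centred average along squares: its expectation is at most
    \<open>k^2 * V / k^4\<close>, which is summable in \<open>k\<close>.\<close>
  define W where "W k \<omega> = ((\<Sum>i<k\<^sup>2. Z i \<omega>) / real (k\<^sup>2))\<^sup>2" for k \<omega>
  have W_int: "integrable M (W k)" for k
    using expectation_sum_square_indep(1)[OF Z_indep Z_sq Z_mean, of "k\<^sup>2"]
    by (simp add: W_def[abs_def] power_divide)
  have W_bound: "expectation (W k) \<le> V / (real k)\<^sup>2" for k
  \<comment> \<open>For \<open>k = 0\<close> both sides are 0, because division by zero yields
    0.\<close>
  proof (cases "k = 0")
    case False
    have "expectation (W k) = (\<Sum>i<k\<^sup>2. expectation (\<lambda>\<omega>. (Z i \<omega>)\<^sup>2)) / (real (k\<^sup>2))\<^sup>2"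
      using expectation_sum_square_indep[OF Z_indep Z_sq Z_mean, of "k\<^sup>2"]
      by (simp add: W_def[abs_def] power_divide)
    also have "\<dots> \<le> (real (k\<^sup>2) * V) / (real (k\<^sup>2))\<^sup>2"
      using sum_mono[of "{..<k\<^sup>2}", OF Z_var] by (intro divide_right_mono) auto
    also have "\<dots> = V / (real k)\<^sup>2"
      using False by (simp add: power2_eq_square)
    finally show ?thesis .
  qed (simp add: W_def[abs_def])
  have V: "0 \<le> V" by (rule order_trans[OF _ Z_var[of 0]]) simp
  have summ: "summable (\<lambda>k. V / (real k)\<^sup>2)"
    using summable_mult[OF inverse_power_summable[of 2, where 'a = real], of V]
    by (simp add: field_simps)
  \<comment> \<open>By monotone convergence the series of the \<open>W k\<close> has finite
    expectation. It is therefore finite almost surely, which forces its terms to 0.\<close>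
  have "(\<integral>\<^sup>+\<omega>. (\<Sum>k. ennreal (W k \<omega>)) \<partial>M) = (\<Sum>k. \<integral>\<^sup>+\<omega>. ennreal (W k \<omega>) \<partial>M)"
    unfolding W_def by (intro nn_integral_suminf) measurable
  also have "\<dots> \<le> (\<Sum>k. ennreal (V / (real k)\<^sup>2))"
  proof (intro suminf_le summableI)
    show "(\<integral>\<^sup>+\<omega>. ennreal (W k \<omega>) \<partial>M) \<le> ennreal (V / (real k)\<^sup>2)" for k
      using W_bound[of k] by (subst nn_integral_eq_integral[OF W_int]) (auto simp: W_def intro!: ennreal_leI)
  qed
  also have "\<dots> < \<infinity>"
    unfolding infinity_ennreal_def less_top[symmetric] using V by (intro ennreal_suminf_neq_top summ) simp
  finally have "AE \<omega> in M. (\<Sum>k. ennreal (W k \<omega>)) \<noteq> \<infinity>"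
    by (intro nn_integral_PInf_AE) (auto simp: W_def[abs_def])
  then show ?thesis
  proof (rule AE_mp[OF _ AE_I2], intro impI)
    fix \<omega> assume "(\<Sum>k. ennreal (W k \<omega>)) \<noteq> \<infinity>"
    then have "summable (\<lambda>k. W k \<omega>)"
      by (intro summable_suminf_not_top) (auto simp: W_def)
    then have "(\<lambda>k. W k \<omega>) \<longlonglongrightarrow> 0"
      by (rule summable_LIMSEQ_zero)
    then have "(\<lambda>k. sqrt (W k \<omega>)) \<longlonglongrightarrow> sqrt 0"
      by (rule tendsto_real_sqrt)
    then have "(\<lambda>k. (\<Sum>i<k\<^sup>2. Z i \<omega>) / real (k\<^sup>2)) \<longlonglongrightarrow> 0"
      unfolding W_def real_sqrt_abs real_sqrt_zero by (rule tendsto_rabs_zero_cancel)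
    then have "(\<lambda>k. (\<Sum>i<k\<^sup>2. Z i \<omega>) / real (k\<^sup>2) + \<mu>) \<longlonglongrightarrow> 0 + \<mu>"
      by (intro tendsto_intros)
    \<comment> \<open>At \<open>k = 0\<close> the left side is \<mu> and the right side is 0, so the
      identity holds only eventually.\<close>
    moreover have "\<forall>\<^sub>F k in sequentially.
        (\<Sum>i<k\<^sup>2. Z i \<omega>) / real (k\<^sup>2) + \<mu> = (\<Sum>i<k\<^sup>2. Y i \<omega>) / real (k\<^sup>2)"
      using eventually_gt_at_top[of 0]
      by eventually_elim (simp add: Z_def sum_subtractf field_simps)
    ultimately have "(\<lambda>k. (\<Sum>i<k\<^sup>2. Y i \<omega>) / real (k\<^sup>2)) \<longlonglongrightarrow> \<mu>"
      using Lim_transform_eventually by fastforce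
    then show "(\<lambda>n. (\<Sum>i<n. Y i \<omega>) / real n) \<longlonglongrightarrow> \<mu>"
      by (intro averages_tendsto_of_square_subsequence incseq_SucI) (auto simp: nonneg)
  qed
qed

text \<open>The positive and negative parts of \<open>g\<close> are nonnegative and dominated by
  \<open>\<bar>g\<bar>\<close>, so the law for nonnegative variables applies to each; subtracting
  the two limits gives the claim.\<close>

lemma (in prob_space) strong_law_square_integrable:
  fixes X :: "nat \<Rightarrow> 'a \<Rightarrow> real" and g :: "real \<Rightarrow> real"
  assumes indep: "indep_vars (\<lambda>_. borel) X UNIV"
    and dist: "\<And>i. distr M borel (X i) = Q"
    and g[measurable]: "g \<in> borel_measurable borel"
    and sq: "integrable Q (\<lambda>x. (g x)\<^sup>2)"
  shows "AE \<omega> in M. (\<lambda>n. (\<Sum>i<n. g (X i \<omega>)) / real n) \<longlonglongrightarrow> (\<integral>x. g x \<partial>Q)"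
proof -
  have rv[measurable]: "random_variable borel (X i)" for i
    using indep by (auto simp: indep_vars_def2)
  have Q: "prob_space Q" using dist prob_space_distr[OF rv] by metis
  have [simp]: "sets Q = sets borel" by (simp add: dist[of 0, symmetric])
  note [measurable_cong] = this
  have law: "AE \<omega> in M. (\<lambda>n. (\<Sum>i<n. h (X i \<omega>)) / real n) \<longlonglongrightarrow> (\<integral>x. h x \<partial>Q)"
    if [measurable]: "h \<in> borel_measurable borel" and "\<And>x. 0 \<le> h x" and hg: "\<And>x. h x \<le> \<bar>g x\<bar>" for h
  proof (rule strong_law_nonneg[where Y = "\<lambda>i \<omega>. h (X i \<omega>)"])
    show "indep_vars (\<lambda>_. borel) (\<lambda>i \<omega>. h (X i \<omega>)) UNIV"
      using indep_vars_compose2[OF indep, of "\<lambda>_. h" "\<lambda>_. borel"] by simp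
    have sq_h: "integrable Q (\<lambda>x. (h x)\<^sup>2)"
      using that by (intro Bochner_Integration.integrable_bound[OF sq]) (auto simp: abs_le_square_iff[symmetric])
    show "integrable M (\<lambda>\<omega>. (h (X i \<omega>))\<^sup>2)" for i
      using sq_h by (subst integrable_distr_eq[of "X i" M borel "\<lambda>x. (h x)\<^sup>2", symmetric]) (auto simp: dist)
    show eq: "expectation (\<lambda>\<omega>. h (X i \<omega>)) = (\<integral>x. h x \<partial>Q)" for i
      by (subst dist[of i, symmetric]) (simp add: integral_distr)
    show "variance (\<lambda>\<omega>. h (X i \<omega>)) \<le> (\<integral>x. (h x - (\<integral>x. h x \<partial>Q))\<^sup>2 \<partial>Q)" for i
      unfolding eq by (subst (2) dist[of i, symmetric]) (simp add: integral_distr)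
  qed (use that in auto)
  have int: "integrable Q g"
    using finite_measure.square_integrable_imp_integrable[OF prob_space.finite_measure[OF Q] _ sq] by simp
  have pos: "integrable Q (\<lambda>x. max 0 (g x))" and neg: "integrable Q (\<lambda>x. max 0 (- g x))"
    using int by auto
  have "(\<integral>x. max 0 (g x) \<partial>Q) - (\<integral>x. max 0 (- g x) \<partial>Q) = (\<integral>x. max 0 (g x) - max 0 (- g x) \<partial>Q)"
    using pos neg by simp
  also have "\<dots> = (\<integral>x. g x \<partial>Q)"
    by (intro Bochner_Integration.integral_cong) auto
  finally have mean: "(\<integral>x. max 0 (g x) \<partial>Q) - (\<integral>x. max 0 (- g x) \<partial>Q) = (\<integral>x. g x \<partial>Q)" .
  have "AE \<omega> in M. (\<lambda>n. (\<Sum>i<n. max 0 (g (X i \<omega>))) / real n) \<longlonglongrightarrow> (\<integral>x. max 0 (g x) \<partial>Q)"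
    by (rule law) auto
  moreover have "AE \<omega> in M. (\<lambda>n. (\<Sum>i<n. max 0 (- g (X i \<omega>))) / real n) \<longlonglongrightarrow> (\<integral>x. max 0 (- g x) \<partial>Q)"
    by (rule law) auto
  ultimately show ?thesis
  proof eventually_elim
    case (elim \<omega>)
    have "g x = max 0 (g x) - max 0 (- g x)" for x by simp
    then have "(\<Sum>i<n. g (X i \<omega>)) / real n
        = (\<Sum>i<n. max 0 (g (X i \<omega>))) / real n - (\<Sum>i<n. max 0 (- g (X i \<omega>))) / real n" for n
      by (simp add: sum_subtractf diff_divide_distrib[symmetric] flip: sum_subtractf)
    then show ?case
      using tendsto_diff[OF elim] by (simp add: mean)
  qed
qed

section \<open>From pointwise to uniform convergence on a compact set\<close>

text \<open>A finite net of points of \<open>T\<close> reduces the claim to finitely many pointwise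
  limits. The Lipschitz bounds control the passage from a point to its nearby net point, for
  \<open>F n\<close> and for \<open>L\<close>, at a cost of \<open>e / 3\<close> each.\<close>

lemma uniform_limit_of_Lipschitz:
  fixes F :: "nat \<Rightarrow> 'p::metric_space \<Rightarrow> real"
  assumes S: "compact S" and T: "T \<subseteq> S" "S \<subseteq> closure T"
    and lipF: "\<And>n x y. x \<in> S \<Longrightarrow> y \<in> S \<Longrightarrow> \<bar>F n x - F n y\<bar> \<le> h n * dist x y"
    and h: "h \<longlonglongrightarrow> c"
    and lipL: "\<And>x y. x \<in> S \<Longrightarrow> y \<in> S \<Longrightarrow> \<bar>L x - L y\<bar> \<le> c * dist x y"
    and lim: "\<And>x. x \<in> T \<Longrightarrow> (\<lambda>n. F n x) \<longlonglongrightarrow> L x"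
  shows "uniform_limit S F L sequentially"
proof (rule uniform_limitI)
  fix e :: real assume e: "e > 0"
  \<comment> \<open>The added 1 puts \<open>c'\<close> strictly above \<open>c\<close>, hence
    eventually above \<open>h n\<close>, and makes it positive, so that the radius \<open>d\<close>
    is well defined.\<close>
  define c' where "c' = \<bar>c\<bar> + 1"
  define d where "d = e / (3 * c')"
  have c': "c' > 0" by (simp add: c'_def)
  with e have d: "d > 0" "c' * d = e / 3" by (auto simp: d_def)
  have "S \<subseteq> (\<Union>t\<in>T. ball t d)"
  proof
    fix x assume "x \<in> S"
    with T d obtain t where "t \<in> T" "dist t x < d"
      by (meson closure_approachable subsetD)
    then show "x \<in> (\<Union>t\<in>T. ball t d)" by auto
  qed
  then obtain U where U: "U \<subseteq> T" "finite U" "S \<subseteq> (\<Union>t\<in>U. ball t d)"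
    using compactE_image[OF S, of T "\<lambda>t. ball t d"] by (metis open_ball)
  have "\<forall>\<^sub>F n in sequentially. \<forall>t\<in>U. dist (F n t) (L t) < e / 3"
    using U e by (intro eventually_ball_finite ballI tendstoD lim) auto
  moreover have "\<forall>\<^sub>F n in sequentially. h n < c'"
    using h by (rule order_tendstoD(2)) (simp add: c'_def)
  ultimately show "\<forall>\<^sub>F n in sequentially. \<forall>x\<in>S. dist (F n x) (L x) < e"
  proof eventually_elim
    case (elim n)
    show ?case
    proof
      fix x assume x: "x \<in> S"
      then obtain t where t: "t \<in> U" "dist x t < d" using U by (auto simp: dist_commute)
      with U T have tS: "t \<in> S" by auto
      have "\<bar>F n x - F n t\<bar> \<le> h n * dist x t" by (rule lipF[OF x tS])
      also have "\<dots> \<le> c' * d" using elim(2) t c' by (intro mult_mono) auto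
      finally have 1: "\<bar>F n x - F n t\<bar> \<le> e / 3" using d by simp
      have "\<bar>L x - L t\<bar> \<le> c * dist x t" by (rule lipL[OF x tS])
      also have "\<dots> \<le> c' * d" using t c' by (intro mult_mono) (auto simp: c'_def)
      finally have 2: "\<bar>L x - L t\<bar> \<le> e / 3" using d by simp
      from elim(1) t have "\<bar>F n t - L t\<bar> < e / 3" by (auto simp: dist_real_def)
      with 1 2 show "dist (F n x) (L x) < e" unfolding dist_real_def by linarith
    qed
  qed
qed

text \<open>Nonemptiness keeps the supremum nonnegative: in \<open>ereal\<close> the supremum over
  the empty set is minus infinity.\<close>

lemma SUP_ereal_tendsto_zero_of_uniform_limit:
  fixes F :: "nat \<Rightarrow> 'p \<Rightarrow> real"
  assumes lim: "uniform_limit S F L sequentially" and S: "S \<noteq> {}"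
  shows "(\<lambda>n. SUP x\<in>S. ereal \<bar>F n x - L x\<bar>) \<longlonglongrightarrow> 0"
proof (rule order_tendstoI)
  fix a :: ereal assume "a < 0"
  obtain x where x: "x \<in> S" using S by auto
  have "a < (SUP x\<in>S. ereal \<bar>F n x - L x\<bar>)" for n
    using SUP_upper[OF x, of "\<lambda>x. ereal \<bar>F n x - L x\<bar>"] \<open>a < 0\<close>
    by (meson abs_ge_zero ereal_less_eq(5) less_le_trans order_trans)
  then show "\<forall>\<^sub>F n in sequentially. a < (SUP x\<in>S. ereal \<bar>F n x - L x\<bar>)" by simp
next
  fix a :: ereal assume "0 < a"
  \<comment> \<open>Strict pointwise bounds by \<open>e\<close> give only a weak bound on the
    supremum; the gap between \<open>e\<close> and \<open>a\<close> restores strictness.\<close>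
  then obtain e where e: "0 < e" "ereal e < a"
    using ereal_dense2[of 0 a] by (auto simp: zero_ereal_def)
  from uniform_limitD[OF lim e(1)]
  show "\<forall>\<^sub>F n in sequentially. (SUP x\<in>S. ereal \<bar>F n x - L x\<bar>) < a"
  proof eventually_elim
    case (elim n)
    then have "(SUP x\<in>S. ereal \<bar>F n x - L x\<bar>) \<le> ereal e"
      by (intro SUP_least) (auto simp: dist_real_def less_imp_le)
    with e show ?case by simp
  qed
qed

section \<open>Lipschitz estimates for a single log-component\<close>

text \<open>For \<open>p > 0\<close> this is the logarithm of a weighted Gaussian density with
  standard deviation \<open>exp t\<close>, expanded so that weight, scale and quadratic term can be
  estimated separately.\<close>

definition log_component :: "real \<Rightarrow> real \<Rightarrow> real \<Rightarrow> real \<Rightarrow> real" where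
  "log_component p \<mu> t x = ln p - t - (x - \<mu>)\<^sup>2 * exp (- 2 * t) / 2 - ln (sqrt (2 * pi))"

lemma exp_log_component:
  assumes "0 < p"
  shows "exp (log_component p \<mu> t x) = p * normal_density \<mu> (exp t) x"
proof -
  define s where "s = exp t"
  have s: "0 < s" by (simp add: s_def)
  have E: "exp (- 2 * t) = 1 / s\<^sup>2"
    by (simp add: s_def exp_minus exp_double inverse_eq_divide)
  have R: "sqrt (2 * pi * s\<^sup>2) = s * sqrt (2 * pi)"
    using s by (simp add: real_sqrt_mult)
  have "log_component p \<mu> t x = ln p - t + - (x - \<mu>)\<^sup>2 / (2 * s\<^sup>2) - ln (sqrt (2 * pi))"
    unfolding log_component_def E by simp
  then have "exp (log_component p \<mu> t x)
      = exp (ln p) / exp t * exp (- (x - \<mu>)\<^sup>2 / (2 * s\<^sup>2)) / exp (ln (sqrt (2 * pi)))"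
    by (simp only: exp_diff exp_add)
  also have "\<dots> = p / s * exp (- (x - \<mu>)\<^sup>2 / (2 * s\<^sup>2)) / sqrt (2 * pi)"
    using assms by (simp add: s_def)
  also have "\<dots> = p * normal_density \<mu> s x"
    unfolding normal_density_def R by simp
  finally show ?thesis by (simp add: s_def)
qed

text \<open>The summands bound, in order, the variation of \<open>ln p\<close>, of \<open>t\<close>,
  and of the quadratic term in \<mu> and \<open>t\<close>.\<close>

definition log_lipschitz_const :: "real \<Rightarrow> real \<Rightarrow> real" where
  "log_lipschitz_const m \<epsilon> = 1 / \<epsilon> + 1 + exp (2 * m) * (3 + m + 2 * m\<^sup>2)"

text \<open>A one-sided bound is enough, since the two parameters can later be exchanged. Each of
  the three varying terms contributes a multiple of \<open>(1 + x^2) * d\<close>.\<close>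

lemma log_component_diff_le:
  assumes m: "0 \<le> m" and \<epsilon>: "0 < \<epsilon>"
    and p: "\<epsilon> \<le> p" "\<epsilon> \<le> p'"
    and \<mu>: "\<bar>\<mu>\<bar> \<le> m" "\<bar>\<mu>'\<bar> \<le> m"
    and t': "\<bar>t'\<bar> \<le> m"
    and d: "\<bar>p - p'\<bar> \<le> d" "\<bar>\<mu> - \<mu>'\<bar> \<le> d" "\<bar>t - t'\<bar> \<le> d"
  shows "log_component p \<mu> t x - log_component p' \<mu>' t' x \<le> log_lipschitz_const m \<epsilon> * (1 + x\<^sup>2) * d"
proof -
  have d0: "0 \<le> d" using d(1) by linarith
  \<comment> \<open>Everything is majorised by multiples of \<open>1 + x^2\<close>: constants
    through \<open>x1\<close>, linear terms through \<open>abs_x\<close>.\<close>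
  have x1: "1 \<le> 1 + x\<^sup>2" by simp
  have abs_x: "2 * \<bar>x\<bar> \<le> 1 + x\<^sup>2"
    using sum_squares_bound[of "\<bar>x\<bar>" 1] by simp
  have E: "exp (- 2 * t') \<le> exp (2 * m)" using t' by simp
  have "ln p - ln p' \<le> (p - p') / p'" using p \<epsilon> by (intro ln_diff_le) auto
  also have "\<dots> \<le> d / \<epsilon>" using d(1) p \<epsilon> d0 by (intro frac_le) auto
  also have "\<dots> \<le> d / \<epsilon> * (1 + x\<^sup>2)" using mult_left_mono[OF x1, of "d / \<epsilon>"] d0 \<epsilon> by simp
  finally have weight: "ln p - ln p' \<le> d / \<epsilon> * (1 + x\<^sup>2)" .
  have scale: "t' - t \<le> d * (1 + x\<^sup>2)" using d(3) mult_left_mono[OF x1 d0] by linarith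
  have "(x - \<mu>')\<^sup>2 - (x - \<mu>)\<^sup>2 = (\<mu> - \<mu>') * (2 * x - \<mu> - \<mu>')"
    by (simp add: power2_eq_square algebra_simps)
  also have "\<dots> \<le> \<bar>\<mu> - \<mu>'\<bar> * \<bar>2 * x - \<mu> - \<mu>'\<bar>"
    by (metis abs_ge_self abs_mult)
  also have "\<dots> \<le> d * (2 * \<bar>x\<bar> + 2 * m)"
    using d(2) \<mu> by (intro mult_mono) auto
  also have "\<dots> \<le> d * ((1 + 2 * m) * (1 + x\<^sup>2))"
    using abs_x mult_left_mono[OF x1, of "2 * m"] m d0 by (intro mult_left_mono) (auto simp: distrib_right)
  finally have "((x - \<mu>')\<^sup>2 - (x - \<mu>)\<^sup>2) * exp (- 2 * t') \<le> d * ((1 + 2 * m) * (1 + x\<^sup>2)) * exp (- 2 * t')"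
    by (rule mult_right_mono) simp
  also have "\<dots> \<le> d * ((1 + 2 * m) * (1 + x\<^sup>2)) * exp (2 * m)"
    using d0 m E by (intro mult_left_mono) auto
  finally have mean: "((x - \<mu>')\<^sup>2 - (x - \<mu>)\<^sup>2) * exp (- 2 * t') \<le> d * ((1 + 2 * m) * (1 + x\<^sup>2)) * exp (2 * m)" .
  \<comment> \<open>Factoring out \<open>exp (- 2 * t')\<close> leaves a term controlled by the
    inequality \<open>1 + y \<le> exp y\<close> at \<open>y = 2 * t' - 2 * t\<close>.\<close>
  have "exp (- 2 * t') - exp (- 2 * t) = exp (- 2 * t') * (1 - exp (2 * t' - 2 * t))"
    by (simp add: right_diff_distrib flip: exp_add)
  also have "\<dots> \<le> exp (- 2 * t') * (2 * d)"
  proof (rule mult_left_mono)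
    show "1 - exp (2 * t' - 2 * t) \<le> 2 * d"
      using exp_ge_add_one_self[of "2 * t' - 2 * t"] d(3) by linarith
  qed simp
  also have "\<dots> \<le> exp (2 * m) * (2 * d)"
    using E d0 by (intro mult_right_mono) auto
  finally have exp_diff: "exp (- 2 * t') - exp (- 2 * t) \<le> exp (2 * m) * (2 * d)" .
  have "(x - \<mu>)\<^sup>2 \<le> 2 * x\<^sup>2 + 2 * \<mu>\<^sup>2"
    using sum_squares_bound[of x "-\<mu>"] by (simp add: power2_diff)
  also have "\<mu>\<^sup>2 \<le> m\<^sup>2" using power_mono[OF \<mu>(1), of 2] by simp
  finally have "(x - \<mu>)\<^sup>2 \<le> (2 + 2 * m\<^sup>2) * (1 + x\<^sup>2)"
    by (simp add: algebra_simps) (smt (verit) mult_nonneg_nonneg zero_le_power2)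
  then have "(x - \<mu>)\<^sup>2 * (exp (- 2 * t') - exp (- 2 * t)) \<le> ((2 + 2 * m\<^sup>2) * (1 + x\<^sup>2)) * (exp (2 * m) * (2 * d))"
    using exp_diff d0
    by (meson mult_left_mono mult_right_mono order_trans zero_le_power2 mult_nonneg_nonneg exp_ge_zero zero_le_numeral)
  \<comment> \<open>The increment is split by changing the mean at scale \<open>t'\<close> and then
    the scale at mean \<mu>; the constants add up to
    \<open>(1 + 2 * m) + 2 * (2 + 2 * m^2)\<close>.\<close>
  with mean have square: "(x - \<mu>')\<^sup>2 * exp (- 2 * t') - (x - \<mu>)\<^sup>2 * exp (- 2 * t)
      \<le> exp (2 * m) * (5 + 2 * m + 4 * m\<^sup>2) * (1 + x\<^sup>2) * d"
    by (simp add: algebra_simps)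
  \<comment> \<open>Rounding 5 up to 6 lets the factor halve to \<open>3 + m + 2 * m^2\<close>, as
    in the Lipschitz constant.\<close>
  also have "\<dots> \<le> exp (2 * m) * (6 + 2 * m + 4 * m\<^sup>2) * (1 + x\<^sup>2) * d"
    using d0 m by (intro mult_right_mono mult_left_mono) auto
  finally have "(x - \<mu>')\<^sup>2 * exp (- 2 * t') / 2 - (x - \<mu>)\<^sup>2 * exp (- 2 * t) / 2
      \<le> exp (2 * m) * (3 + m + 2 * m\<^sup>2) * (1 + x\<^sup>2) * d"
    by (simp add: algebra_simps)
  moreover have "log_lipschitz_const m \<epsilon> * (1 + x\<^sup>2) * d = d / \<epsilon> * (1 + x\<^sup>2) + d * (1 + x\<^sup>2)
      + exp (2 * m) * (3 + m + 2 * m\<^sup>2) * (1 + x\<^sup>2) * d"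
    by (simp add: log_lipschitz_const_def algebra_simps)
  ultimately show ?thesis
    using weight scale unfolding log_component_def by linarith
qed

section \<open>The sieve and the log-density of mixtures on it\<close>

lemma sieve_iff:
  assumes "0 < \<epsilon>"
  shows "(\<pi>, \<mu>, t) \<in> sieve m \<epsilon> \<longleftrightarrow> (\<forall>j. \<pi> $ j \<in> {\<epsilon>..1}) \<and> (\<Sum>j\<in>UNIV. \<pi> $ j) = 1
    \<and> (\<forall>j. \<mu> $ j \<in> {-m..m}) \<and> (\<forall>j. t $ j \<in> {-m..m})"
proof -
  have "\<epsilon> \<le> (MIN j. \<pi> $ j) \<longleftrightarrow> (\<forall>j. \<epsilon> \<le> \<pi> $ j)" by (subst Min_ge_iff) auto
  then show ?thesis
    using assms by (auto simp: sieve_def prob_simplex_def intro: less_imp_le order_trans)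
qed

text \<open>The weights form a compact box cut by a closed hyperplane; the means and log-scales each
  range over a compact box.\<close>

lemma compact_sieve:
  assumes "0 < \<epsilon>"
  shows "compact (sieve m \<epsilon> :: 'k::finite param set)"
proof -
  have "sieve m \<epsilon> = (cbox (\<chi> j. \<epsilon>) (\<chi> j. 1) \<inter> {\<pi>. (\<Sum>j\<in>UNIV. \<pi> $ j) = 1})
      \<times> cbox (\<chi> j. - m) (\<chi> j. m) \<times> (cbox (\<chi> j. - m) (\<chi> j. m) :: (real ^ 'k) set)"
    using sieve_iff[OF assms] by (auto simp: mem_box_cart)
  moreover have "closed {\<pi> :: real ^ 'k. (\<Sum>j\<in>UNIV. \<pi> $ j) = 1}"
    by (intro closed_Collect_eq continuous_intros)
  ultimately show ?thesis
    by (simp add: compact_Times compact_Int_closed)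
qed

lemma mixture_density_pos:
  fixes \<theta> :: "'k::finite param"
  assumes "\<theta> \<in> sieve m \<epsilon>" "0 < \<epsilon>"
  shows "0 < mixture_density \<theta> x"
proof (cases \<theta>)
  case (fields \<pi> \<mu> t)
  have "0 < \<pi> $ j" for j
    using assms sieve_iff[OF assms(2), of \<pi> \<mu> t m] fields by (auto intro: less_le_trans)
  then show ?thesis
    unfolding fields mixture_density_def by (auto intro!: sum_pos mult_pos_pos normal_density_pos)
qed

lemma borel_measurable_mixture_density [measurable]:
  "mixture_density \<theta> \<in> borel_measurable borel"
  by (cases \<theta>) (simp add: mixture_density_def)

text \<open>The logarithm does not pass through the sum over components, so the comparison is
  multiplicative: every component of \<theta> is at most \<open>exp K\<close> times the matching one
  of \<open>\<theta>'\<close> with the same \<open>K\<close>, and this factor survives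
  summation.\<close>

lemma ln_mixture_density_Lipschitz:
  fixes \<theta> \<theta>' :: "'k::finite param"
  assumes \<theta>: "\<theta> \<in> sieve m \<epsilon>" "\<theta>' \<in> sieve m \<epsilon>" and m: "0 \<le> m" and \<epsilon>: "0 < \<epsilon>"
  shows "\<bar>ln (mixture_density \<theta> x) - ln (mixture_density \<theta>' x)\<bar>
    \<le> log_lipschitz_const m \<epsilon> * (1 + x\<^sup>2) * dist \<theta> \<theta>'"
proof -
  have le: "ln (mixture_density \<theta> x) - ln (mixture_density \<theta>' x)
      \<le> log_lipschitz_const m \<epsilon> * (1 + x\<^sup>2) * dist \<theta> \<theta>'"
    if \<theta>: "\<theta> \<in> sieve m \<epsilon>" "\<theta>' \<in> sieve m \<epsilon>" for \<theta> \<theta>' :: "'k param"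
  proof (cases \<theta>, cases \<theta>')
    fix \<pi> \<mu> t \<pi>' \<mu>' t' assume eq: "\<theta> = (\<pi>, \<mu>, t)" "\<theta>' = (\<pi>', \<mu>', t')"
    define K where "K = log_lipschitz_const m \<epsilon> * (1 + x\<^sup>2) * dist \<theta> \<theta>'"
    have bounds: "\<And>j. \<epsilon> \<le> \<pi> $ j" "\<And>j. \<epsilon> \<le> \<pi>' $ j" "\<And>j. \<bar>\<mu> $ j\<bar> \<le> m" "\<And>j. \<bar>\<mu>' $ j\<bar> \<le> m"
        "\<And>j. \<bar>t' $ j\<bar> \<le> m"
      using \<theta> unfolding eq sieve_iff[OF \<epsilon>] by (auto simp: abs_le_iff minus_le_iff)
    have coord: "\<bar>u $ j - v $ j\<bar> \<le> dist u v" for u v :: "real ^ 'k" and j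
      using component_le_norm_cart[of "u - v" j] by (simp add: dist_norm)
    have "dist \<pi> \<pi>' \<le> dist \<theta> \<theta>'" "dist (\<mu>, t) (\<mu>', t') \<le> dist \<theta> \<theta>'"
      using dist_fst_le[of \<theta> \<theta>'] dist_snd_le[of \<theta> \<theta>'] by (simp_all add: eq)
    moreover have "dist \<mu> \<mu>' \<le> dist (\<mu>, t) (\<mu>', t')" "dist t t' \<le> dist (\<mu>, t) (\<mu>', t')"
      using dist_fst_le[of "(\<mu>, t)" "(\<mu>', t')"] dist_snd_le[of "(\<mu>, t)" "(\<mu>', t')"] by simp_all
    ultimately have "log_component (\<pi> $ j) (\<mu> $ j) (t $ j) x
        - log_component (\<pi>' $ j) (\<mu>' $ j) (t' $ j) x \<le> K" for j
      unfolding K_def using coord[of \<pi> j \<pi>'] coord[of \<mu> j \<mu>'] coord[of t j t']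
      by (intro log_component_diff_le m \<epsilon> bounds) linarith+
    then have "exp (log_component (\<pi> $ j) (\<mu> $ j) (t $ j) x)
        \<le> exp K * exp (log_component (\<pi>' $ j) (\<mu>' $ j) (t' $ j) x)" for j
      by (simp flip: exp_add add: diff_le_eq)
    moreover have "0 < \<pi> $ j" "0 < \<pi>' $ j" for j using bounds(1,2)[of j] \<epsilon> by auto
    ultimately have "mixture_density \<theta> x \<le> exp K * mixture_density \<theta>' x"
      unfolding eq mixture_density_def
      by (auto simp: exp_log_component sum_distrib_left intro!: sum_mono)
    then have "ln (mixture_density \<theta> x) \<le> ln (exp K * mixture_density \<theta>' x)"
      using mixture_density_pos[OF \<theta>(1) \<epsilon>] mixture_density_pos[OF \<theta>(2) \<epsilon>]
      by (subst ln_le_cancel_iff) auto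
    also have "\<dots> = K + ln (mixture_density \<theta>' x)"
      using mixture_density_pos[OF \<theta>(2) \<epsilon>, of x] by (simp add: ln_mult)
    finally show ?thesis by (simp add: K_def)
  qed
  show ?thesis
    using le[OF \<theta>] le[OF \<theta>(2) \<theta>(1)] by (auto simp: abs_le_iff dist_commute)
qed

text \<open>Equal weights with zero means and log-scales represent the standard normal law. This
  point shows that the sieve is nonempty and serves as reference for growth bounds.\<close>

lemma standard_normal_in_sieve:
  assumes "0 \<le> m" "0 < \<epsilon>" "\<epsilon> \<le> 1 / real CARD('k)"
  shows "((\<chi> j. 1 / real CARD('k), 0, 0) :: 'k::finite param) \<in> sieve m \<epsilon>"
  using assms by (subst sieve_iff) auto

text \<open>At the standard normal the log-density is an explicit quadratic; the Lipschitz estimate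
  carries its growth rate to \<theta>, with \<open>B\<close> depending on \<theta>.\<close>

lemma abs_ln_mixture_density_le:
  fixes \<theta> :: "'k::finite param"
  assumes \<theta>: "\<theta> \<in> sieve m \<epsilon>" and m: "0 \<le> m" and \<epsilon>: "0 < \<epsilon>" "\<epsilon> \<le> 1 / real CARD('k)"
  obtains B where "\<And>x. \<bar>ln (mixture_density \<theta> x)\<bar> \<le> B * (1 + x\<^sup>2)"
proof
  fix x :: real
  define \<theta>r :: "'k param" where "\<theta>r = (\<chi> j. 1 / real CARD('k), 0, 0)"
  have "mixture_density \<theta>r x = normal_density 0 1 x"
    by (simp add: mixture_density_def \<theta>r_def)
  also have "ln \<dots> = - x\<^sup>2 / 2 - ln (sqrt (2 * pi))"
    by (simp add: normal_density_def ln_mult ln_div)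
  finally have "\<bar>ln (mixture_density \<theta>r x)\<bar> \<le> x\<^sup>2 / 2 + \<bar>ln (sqrt (2 * pi))\<bar>"
    using zero_le_power2[of x] by linarith
  also have "\<dots> \<le> (1 + \<bar>ln (sqrt (2 * pi))\<bar>) * (1 + x\<^sup>2)"
    by (simp add: algebra_simps add_increasing2)
  finally have "\<bar>ln (mixture_density \<theta>r x)\<bar> \<le> (1 + \<bar>ln (sqrt (2 * pi))\<bar>) * (1 + x\<^sup>2)" .
  moreover have "\<theta>r \<in> sieve m \<epsilon>" unfolding \<theta>r_def by (rule standard_normal_in_sieve[OF m \<epsilon>])
  from ln_mixture_density_Lipschitz[OF \<theta> this m \<epsilon>(1), of x]
  have "\<bar>ln (mixture_density \<theta> x) - ln (mixture_density \<theta>r x)\<bar>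
      \<le> log_lipschitz_const m \<epsilon> * dist \<theta> \<theta>r * (1 + x\<^sup>2)"
    by (simp add: mult_ac)
  ultimately show "\<bar>ln (mixture_density \<theta> x)\<bar>
      \<le> (1 + \<bar>ln (sqrt (2 * pi))\<bar> + log_lipschitz_const m \<epsilon> * dist \<theta> (\<chi> j. 1 / real CARD('k), 0, 0)) * (1 + x\<^sup>2)"
    unfolding \<theta>r_def distrib_right[of _ _ "1 + x\<^sup>2"] by linarith
qed

text \<open>The fourth moment enters here, through
  \<open>(1 + x^2)^2 \<le> 2 + 2 * x^4\<close>.\<close>

lemma integrable_square_of_quadratic_growth:
  fixes Q :: "real measure"
  assumes Q: "prob_space Q" and sets: "sets Q = sets borel"
    and fourth: "integrable Q (\<lambda>x. x ^ 4)"
    and g: "g \<in> borel_measurable borel" and bound: "\<And>x. \<bar>g x\<bar> \<le> B * (1 + x\<^sup>2)"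
  shows "integrable Q (\<lambda>x. (g x)\<^sup>2)"
proof (rule Bochner_Integration.integrable_bound)
  interpret prob_space Q by (rule Q)
  show "integrable Q (\<lambda>x. B\<^sup>2 * (2 + 2 * x ^ 4))"
    using fourth by simp
  note [measurable_cong] = sets and [measurable] = g
  show "(\<lambda>x. (g x)\<^sup>2) \<in> borel_measurable Q" by measurable
  have "(g x)\<^sup>2 \<le> B\<^sup>2 * (2 + 2 * x ^ 4)" for x
  proof -
    have "(g x)\<^sup>2 \<le> (B * (1 + x\<^sup>2))\<^sup>2"
      using power_mono[OF bound, of x 2] by simp
    also have "\<dots> = B\<^sup>2 * (1 + x\<^sup>2)\<^sup>2" by (simp add: power_mult_distrib)
    also have "(1 + x\<^sup>2)\<^sup>2 \<le> 2 + 2 * x ^ 4"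
      using sum_squares_bound[of 1 "x\<^sup>2"] by (simp add: power2_sum)
    finally show ?thesis by (simp add: mult_left_mono)
  qed
  then show "AE x in Q. norm ((g x)\<^sup>2) \<le> norm (B\<^sup>2 * (2 + 2 * x ^ 4))" by simp
qed

section \<open>The uniform strong law on the sieve\<close>

theorem proposition4p3:
  fixes P :: "'a measure"
    and X :: "nat \<Rightarrow> 'a \<Rightarrow> real"
    and \<theta>\<^sub>0 :: "'k::finite param"
    and m \<epsilon> :: real
  assumes "CARD('k) \<ge> 2"
    and "\<theta>\<^sub>0 \<in> param_space"
    and "prob_space P"
    and "prob_space.indep_vars P (\<lambda>_. borel) X UNIV"
    and "\<And>i. distributed P lborel (X i) (\<lambda>x. ennreal (mixture_density \<theta>\<^sub>0 x))"
    and "integrable (mixture_measure \<theta>\<^sub>0) (\<lambda>x. x ^ 4)"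
    and "m \<ge> 1"
    and "0 < \<epsilon>" and "\<epsilon> \<le> 1 / real CARD('k)"
  shows "AE \<omega> in P.
    (\<lambda>n. SUP \<theta>\<in>sieve m \<epsilon>. ereal \<bar>emp_loglik (\<lambda>i. X i \<omega>) n \<theta> - pop_loglik \<theta>\<^sub>0 \<theta>\<bar>)
      \<longlonglongrightarrow> 0"
proof -
  interpret prob_space P by fact
  define S :: "'k param set" where "S = sieve m \<epsilon>"
  define Q where "Q = mixture_measure \<theta>\<^sub>0"
  define C where "C = log_lipschitz_const m \<epsilon>"
  \<comment> \<open>The pointwise Lipschitz constant in \<theta> of the log-density at
    \<open>x\<close>; its empirical and population means are the constants for the two
    log-likelihoods.\<close>
  define H where "H x = C * (1 + x\<^sup>2)" for x
  have m: "0 \<le> m" and \<epsilon>: "0 < \<epsilon>" "\<epsilon> \<le> 1 / real CARD('k)" using assms by auto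
  have rv[measurable]: "random_variable borel (X i)" for i
    using assms(4) by (auto simp: indep_vars_def2)
  have dist_Q: "distr P borel (X i) = Q" for i
    using distributed_distr_eq_density[OF assms(5)[of i]]
    by (simp add: Q_def mixture_measure_def cong: distr_cong)
  have sets_Q[measurable_cong]: "sets Q = sets borel"
    by (simp add: Q_def mixture_measure_def)
  have Q: "prob_space Q" using dist_Q[of 0] prob_space_distr[OF rv] by metis
  interpret Q: prob_space Q by (rule Q)
  have fourth: "integrable Q (\<lambda>x. x ^ 4)" using assms(6) by (simp add: Q_def)
  have meas: "(\<lambda>x. ln (mixture_density \<theta> x)) \<in> borel_measurable borel" for \<theta> :: "'k param"
    by measurable
  have H_meas[measurable]: "H \<in> borel_measurable borel"
    unfolding H_def by measurable
  have C: "0 \<le> C" using m \<epsilon> by (simp add: C_def log_lipschitz_const_def)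
  have H_sq: "integrable Q (\<lambda>x. (H x)\<^sup>2)"
    by (rule integrable_square_of_quadratic_growth[OF Q sets_Q fourth, where B = C])
       (use C in \<open>auto simp: H_def abs_mult\<close>)
  have H_int: "integrable Q H"
    using Q.square_integrable_imp_integrable[OF _ H_sq] by simp
  have sq: "integrable Q (\<lambda>x. (ln (mixture_density \<theta> x))\<^sup>2)" if mem: "\<theta> \<in> S" for \<theta> :: "'k param"
  proof -
    obtain B where "\<And>x. \<bar>ln (mixture_density \<theta> x)\<bar> \<le> B * (1 + x\<^sup>2)"
      using abs_ln_mixture_density_le[OF mem[unfolded S_def] m \<epsilon>] by blast
    then show ?thesis
      by (rule integrable_square_of_quadratic_growth[OF Q sets_Q fourth meas])
  qed
  have int: "integrable Q (\<lambda>x. ln (mixture_density \<theta> x))" if "\<theta> \<in> S" for \<theta> :: "'k param"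
    using Q.square_integrable_imp_integrable[OF _ sq[OF that]] by simp
  have lip: "\<bar>ln (mixture_density \<theta> x) - ln (mixture_density \<theta>' x)\<bar> \<le> H x * dist \<theta> \<theta>'"
    if "\<theta> \<in> S" "\<theta>' \<in> S" for \<theta> \<theta>' x
    unfolding H_def C_def using that by (intro ln_mixture_density_Lipschitz m \<epsilon>) (auto simp: S_def)
  have lip_pop: "\<bar>pop_loglik \<theta>\<^sub>0 \<theta> - pop_loglik \<theta>\<^sub>0 \<theta>'\<bar> \<le> (\<integral>x. H x \<partial>Q) * dist \<theta> \<theta>'"
    if "\<theta> \<in> S" "\<theta>' \<in> S" for \<theta> \<theta>'
  proof -
    have "pop_loglik \<theta>\<^sub>0 \<theta> - pop_loglik \<theta>\<^sub>0 \<theta>'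
        = (\<integral>x. ln (mixture_density \<theta> x) - ln (mixture_density \<theta>' x) \<partial>Q)"
      using int that by (simp add: pop_loglik_def Q_def)
    also have "\<bar>\<dots>\<bar> \<le> (\<integral>x. \<bar>ln (mixture_density \<theta> x) - ln (mixture_density \<theta>' x)\<bar> \<partial>Q)"
      by (rule integral_abs_bound)
    also have "\<dots> \<le> (\<integral>x. H x * dist \<theta> \<theta>' \<partial>Q)"
      using int that H_int lip by (intro integral_mono) auto
    finally show ?thesis by simp
  qed
  \<comment> \<open>The case \<open>n = 0\<close> is included: both sides are then 0.\<close>
  have lip_emp: "\<bar>emp_loglik x n \<theta> - emp_loglik x n \<theta>'\<bar> \<le> (\<Sum>i<n. H (x i)) / real n * dist \<theta> \<theta>'"
    if "\<theta> \<in> S" "\<theta>' \<in> S" for \<theta> \<theta>' x n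
  proof -
    have "emp_loglik x n \<theta> - emp_loglik x n \<theta>'
        = (\<Sum>i<n. ln (mixture_density \<theta> (x i)) - ln (mixture_density \<theta>' (x i))) / real n"
      by (simp add: emp_loglik_def sum_subtractf diff_divide_distrib)
    also have "\<bar>\<dots>\<bar> \<le> (\<Sum>i<n. \<bar>ln (mixture_density \<theta> (x i)) - ln (mixture_density \<theta>' (x i))\<bar>) / real n"
      by (simp add: divide_right_mono sum_abs)
    also have "\<dots> \<le> (\<Sum>i<n. H (x i) * dist \<theta> \<theta>') / real n"
      by (intro divide_right_mono sum_mono lip that) simp
    finally show ?thesis by (simp add: sum_distrib_right)
  qed
  \<comment> \<open>Countability of \<open>T\<close> allows the exceptional null sets of its points
    to be combined into one.\<close>
  obtain T where T: "countable T" "T \<subseteq> S" "S \<subseteq> closure T"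
    using separable[of S] by blast
  have "AE \<omega> in P. (\<lambda>n. (\<Sum>i<n. H (X i \<omega>)) / real n) \<longlonglongrightarrow> (\<integral>x. H x \<partial>Q)"
    by (rule strong_law_square_integrable[OF assms(4) dist_Q H_meas H_sq])
  moreover have "AE \<omega> in P. \<forall>\<theta>\<in>T. (\<lambda>n. emp_loglik (\<lambda>i. X i \<omega>) n \<theta>) \<longlonglongrightarrow> pop_loglik \<theta>\<^sub>0 \<theta>"
    unfolding AE_ball_countable[OF T(1)]
  proof
    fix \<theta> assume "\<theta> \<in> T"
    with T have "\<theta> \<in> S" by auto
    from strong_law_square_integrable[OF assms(4) dist_Q meas sq[OF this]]
    show "AE \<omega> in P. (\<lambda>n. emp_loglik (\<lambda>i. X i \<omega>) n \<theta>) \<longlonglongrightarrow> pop_loglik \<theta>\<^sub>0 \<theta>"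
      by (simp add: emp_loglik_def pop_loglik_def Q_def)
  qed
  ultimately show ?thesis
    unfolding S_def[symmetric]
  proof eventually_elim
    \<comment> \<open>For a fixed outcome in both almost sure events the rest is
      deterministic.\<close>
    case (elim \<omega>)
    have "compact S" unfolding S_def by (rule compact_sieve[OF \<epsilon>(1)])
    then have "uniform_limit S (emp_loglik (\<lambda>i. X i \<omega>)) (pop_loglik \<theta>\<^sub>0) sequentially"
      by (rule uniform_limit_of_Lipschitz[OF _ T(2,3) lip_emp elim(1) lip_pop]) (use elim(2) in auto)
    moreover have "S \<noteq> {}" using standard_normal_in_sieve[OF m \<epsilon>] unfolding S_def by blast
    ultimately show ?case by (rule SUP_ereal_tendsto_zero_of_uniform_limit)
  qed
qed

end
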